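(* Let $G$ be a finite, connected, simple undirected graph with vertex set $V=\{v_0,\dots,v_n\}$ and edge set $E$. Let $\mathbb{I}$ be the set of $G$-semiorders, $\mathbb{O}$ the set of $G$-semiorientations, $\mathcal{S}$ the set of quasi-superstable divisors on $G$, and $\mathfrak{S}$ the symmetric group on $\{0,\dots,n\}$. For $P\in\mathbb{I}$ and $v\in V$ let $n_P(v)=|\{u\in V: u<v \text{ in } P,\ \{u,v\}\in E\}|$. Then the formulas $$\theta(P)=\sum_{v\in V}(n_P(v)-1)\,v,\qquad \psi(\mathcal{O})=\sum_{v\in V}(\mathrm{indeg}_{\mathcal{O}}(v)-1)\,v$$ define maps $\theta:\mathbb{I}\to\mathcal{S}$ and $\psi:\mathbb{O}\to\mathcal{S}$. Let $\nu:\mathbb{I}\to\mathbb{O}$, $\nu(P)=\{(u,v):\{u,v\}\in E,\ u<v\text{ in }P\}$, let $\pi:\mathcal{S}\times\mathfrak{S}\to\mathcal{S}$ be the first projection, and let $\phi:\mathcal{S}\times\mathfrak{S}\to\mathbb{I}$ and $\eta:\mathcal{S}\times\mathfrak{S}\to\mathbb{O}$ be the maps given by the superstables algorithm described in the context. Then $\phi$ indeed takes values in $\mathbb{I}$, and $$\theta\circ\phi=\pi,\qquad \nu\circ\phi=\eta,\qquad \psi\circ\eta=\pi,\qquad \psi\circ\nu=\theta.$$ Moreover $\pi$, $\theta$, $\nu$ and $\psi$ are surjective.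
   Context: Partial orientation: a subset $\mathcal{O}\subseteq V\times V$ with $(u,v)\in\mathcal{O}\Rightarrow\{u,v\}\in E$ and $(v,u)\notin\mathcal{O}$; $\mathrm{indeg}_{\mathcal{O}}(v)$ is the number of $(u,v)\in\mathcal{O}$; edges not oriented are blank. A potential cycle is a cycle of $G$ whose blank edges can be directed to make it a directed cycle. A $G$-semiorientation is a partial orientation whose every potential cycle has strictly more blank than oriented edges. A semiorder is a poset isomorphic to the order on a finite set of unit closed intervals $[a,a+1]$ with $[a,a+1]<[b,b+1]$ iff $a+1<b$; a $G$-semiorder is a semiorder on $V$. Sandpiles: for a graph $H$ with a chosen sink vertex $s$, a configuration is an integer vector indexed by the nonsink vertices; firing a set $X$ of nonsink vertices from $c$ gives $c-\widetilde{\Delta}1_X$, where $\widetilde{\Delta}$ is the Laplacian $D-A$ of $H$ with the row and column of $s$ removed. A configuration $c\ge0$ is superstable if there is no nonempty set $X$ of nonsink vertices with $c-\widetilde{\Delta}1_X\ge0$. Let $K(G)$ be $G$ with a new vertex $\tilde q$ joined by an edge to every vertex of $V$, with sink $\tilde q$. A divisor on $G$ is an element $c=\sum_{v\in V}c_v v\in\mathbb{Z}V$. A divisor $c$ is quasi-superstable if $c+1_V$ is a superstable configuration on $K(G)$, where $1_V=\sum_{v\in V}v$. Superstables algorithm (defining $\phi(c,\sigma)$ and $\eta(c,\sigma)$ for $c\in\mathcal{S}$, $\sigma\in\mathfrak{S}$; $\sigma$ is identified with the vertex ordering $v_{\sigma(0)},\dots,v_{\sigma(n)}$). A vertex $v\in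 V$ is unstable in a configuration $b$ on $K(G)$ if $b_v\ge\deg_{K(G)}(v)$; firing $v$ subtracts $\deg_{K(G)}(v)$ from $b_v$ and adds $1$ to $b_w$ for each $G$-neighbor $w$ of $v$. Set $b=c_{\max}-c$ with $c_{\max}=\sum_{v\in V}(\deg_{K(G)}(v)-1)v$. Let $u_1,\dots,u_k$ be the vertices unstable in $b$, listed in the order $\sigma$; set $J(u_i)=[i/(k+1),1+i/(k+1)]$, queue $Q=(u_1,\dots,u_k)$, and $\mathcal{O}=\emptyset$. While $Q=(w_0,\dots,w_\ell)$ is nonempty: write $J(w_0)=[\alpha,\alpha+1]$; if $\ell>0$ define $\varepsilon$ by $J(w_1)=[\alpha+\varepsilon,\alpha+\varepsilon+1]$, otherwise $\varepsilon=1$. Fire $w_0$ in $b$, remove it from $Q$ and mark it as fired (it never re-enters $Q$). Let $z_1,\dots,z_t$ (in the order $\sigma$) be the not-yet-fired vertices that became unstable by this firing; set $J(z_i)=[\alpha+1+i\varepsilon/(t+1),\alpha+2+i\varepsilon/(t+1)]$ and append $z_1,\dots,z_t$ to $Q$. For each edge $\{w_0,v\}\in E$ not yet oriented or marked blank: if $v$ was already unstable before the firing of $w_0$, mark the edge blank; otherwise add $(w_0,v)$ to $\mathcal{O}$. At the end, $\phi(c,\sigma)$ is the order on $V$ with $u<v$ iff $J(u)$ lies strictly to the left of $J(v)$, and $\eta(c,\sigma)=\mathcal{O}$. *)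

theory Defs
  imports
    Complex_Main
    "HOL-Library.FuncSet"
    "HOL-Library.While_Combinator"
    "HOL-Combinatorics.Permutations"
begin

section \<open>Graphs\<close>

definition simple_graph :: "'a set \<Rightarrow> 'a set set \<Rightarrow> bool" where
  "simple_graph V E \<longleftrightarrow>
     finite V \<and> (\<forall>e\<in>E. \<exists>u\<in>V. \<exists>w\<in>V. u \<noteq> w \<and> e = {u, w})"

definition graph_connected :: "'a set \<Rightarrow> 'a set set \<Rightarrow> bool" where
  "graph_connected V E \<longleftrightarrow>
     V \<noteq> {} \<and> (\<forall>u\<in>V. \<forall>w\<in>V. (u, w) \<in> {(x, y). {x, y} \<in> E}\<^sup>*)"

definition graph_degree :: "'a set set \<Rightarrow> 'a \<Rightarrow> nat" where
  "graph_degree E x = card {y. {x, y} \<in> E}"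

text \<open>
  The graph $K(G)$: the new vertex is \<open>None\<close>, and a vertex \<open>v\<close> of $G$ becomes \<open>Some v\<close>.
\<close>

definition cone_verts :: "'a set \<Rightarrow> 'a option set" where
  "cone_verts V = insert None (Some ` V)"

definition cone_edges :: "'a set \<Rightarrow> 'a set set \<Rightarrow> 'a option set set" where
  "cone_edges V E = ((`) Some) ` E \<union> {{None, Some v} | v. v \<in> V}"


section \<open>Semiorientations\<close>

definition partial_orientation :: "'a set \<Rightarrow> 'a set set \<Rightarrow> 'a rel \<Rightarrow> bool" where
  "partial_orientation V E R \<longleftrightarrow>
     R \<subseteq> V \<times> V \<and> (\<forall>u w. (u, w) \<in> R \<longrightarrow> {u, w} \<in> E \<and> (w, u) \<notin> R)"

definition indegree :: "'a rel \<Rightarrow> 'a \<Rightarrow> nat" where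
  "indegree R v = card {u. (u, v) \<in> R}"

definition oriented_edges :: "'a rel \<Rightarrow> 'a set set" where
  "oriented_edges R = {{u, w} | u w. (u, w) \<in> R}"

text \<open>
  A cycle is given by the list of its vertices, and so comes with a direction of traversal;
  the reversed list describes the same cycle traversed the other way.
\<close>

definition cycle_arcs :: "'a list \<Rightarrow> 'a rel" where
  "cycle_arcs c = {(c ! i, c ! (Suc i mod length c)) | i. i < length c}"

definition cycle_edges :: "'a list \<Rightarrow> 'a set set" where
  "cycle_edges c = {{u, w} | u w. (u, w) \<in> cycle_arcs c}"

definition graph_cycle :: "'a set set \<Rightarrow> 'a list \<Rightarrow> bool" where
  "graph_cycle E c \<longleftrightarrow> 3 \<le> length c \<and> distinct c \<and> cycle_edges c \<subseteq> E"

text \<open>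
  The blank edges of the cycle can be directed so that the cycle becomes directed: some
  partial orientation extending \<open>R\<close> contains all its arcs, in one of the two directions.
\<close>

definition potential_cycle :: "'a set \<Rightarrow> 'a set set \<Rightarrow> 'a rel \<Rightarrow> 'a list \<Rightarrow> bool" where
  "potential_cycle V E R c \<longleftrightarrow>
     graph_cycle E c \<and>
     (\<exists>R'. partial_orientation V E R' \<and> R \<subseteq> R' \<and>
           (cycle_arcs c \<subseteq> R' \<or> cycle_arcs (rev c) \<subseteq> R'))"

definition semiorientations :: "'a set \<Rightarrow> 'a set set \<Rightarrow> 'a rel set" where
  "semiorientations V E =
     {R. partial_orientation V E R \<and>
         (\<forall>c. potential_cycle V E R c \<longrightarrow>
              card (cycle_edges c \<inter> oriented_edges R)
                < card (cycle_edges c - oriented_edges R))}"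


section \<open>Semiorders\<close>

text \<open>
  Orders are strict: \<open>(u, w) \<in> P\<close> means \<open>u < w\<close>. The unit interval \<open>[a, a + 1]\<close> is represented
  by its left endpoint \<open>a\<close>. Injectivity expresses that \<open>V\<close> is in bijection with a
  \<^emph>\<open>set\<close> of intervals.
\<close>

definition semiorders :: "'a set \<Rightarrow> 'a rel set" where
  "semiorders V =
     {P. P \<subseteq> V \<times> V \<and>
         (\<exists>a :: 'a \<Rightarrow> real. inj_on a V \<and>
            (\<forall>u\<in>V. \<forall>w\<in>V. (u, w) \<in> P \<longleftrightarrow> a u + 1 < a w))}"


section \<open>Sandpiles\<close>

definition laplacian :: "'a set set \<Rightarrow> 'a \<Rightarrow> 'a \<Rightarrow> int" where
  "laplacian F x y =
     (if x = y then int (graph_degree F x) else 0) - (if {x, y} \<in> F then 1 else 0)"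

text \<open>
  A configuration is a function of which only the values on the nonsink vertices \<open>W - {s}\<close> matter.
\<close>

definition fire_set ::
  "'a set \<Rightarrow> 'a set set \<Rightarrow> 'a \<Rightarrow> 'a set \<Rightarrow> ('a \<Rightarrow> int) \<Rightarrow> 'a \<Rightarrow> int" where
  "fire_set W F s X c x = c x - (\<Sum>y\<in>W - {s}. laplacian F x y * of_bool (y \<in> X))"

definition superstable :: "'a set \<Rightarrow> 'a set set \<Rightarrow> 'a \<Rightarrow> ('a \<Rightarrow> int) \<Rightarrow> bool" where
  "superstable W F s c \<longleftrightarrow>
     (\<forall>x\<in>W - {s}. 0 \<le> c x) \<and>
     \<not> (\<exists>X. X \<noteq> {} \<and> X \<subseteq> W - {s} \<and> (\<forall>x\<in>W - {s}. 0 \<le> fire_set W F s X c x))"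

text \<open>A divisor on $G$ is an integer function vanishing outside \<open>V\<close>.\<close>

definition divisors :: "'a set \<Rightarrow> ('a \<Rightarrow> int) set" where
  "divisors V = {c. \<forall>v. v \<notin> V \<longrightarrow> c v = 0}"

definition quasi_superstables :: "'a set \<Rightarrow> 'a set set \<Rightarrow> ('a \<Rightarrow> int) set" where
  "quasi_superstables V E =
     {c \<in> divisors V.
        superstable (cone_verts V) (cone_edges V E) None
          (\<lambda>x. case x of None \<Rightarrow> 0 | Some v \<Rightarrow> c v + 1)}"


section \<open>The superstables algorithm\<close>

definition cone_degree :: "'a set \<Rightarrow> 'a set set \<Rightarrow> 'a \<Rightarrow> nat" where
  "cone_degree V E v = graph_degree (cone_edges V E) (Some v)"

definition unstable :: "'a set \<Rightarrow> 'a set set \<Rightarrow> ('a \<Rightarrow> int) \<Rightarrow> 'a \<Rightarrow> bool" where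
  "unstable V E b v \<longleftrightarrow> v \<in> V \<and> int (cone_degree V E v) \<le> b v"

definition fire_vertex ::
  "'a set \<Rightarrow> 'a set set \<Rightarrow> 'a \<Rightarrow> ('a \<Rightarrow> int) \<Rightarrow> 'a \<Rightarrow> int" where
  "fire_vertex V E w b =
     (\<lambda>x. if x = w then b x - int (cone_degree V E w)
          else if {w, x} \<in> E then b x + 1 else b x)"

definition cmax :: "'a set \<Rightarrow> 'a set set \<Rightarrow> 'a \<Rightarrow> int" where
  "cmax V E v = int (cone_degree V E v) - 1"

text \<open>\<open>sa_left v\<close> is the left endpoint of the interval $J(v)$.\<close>

record 'a sa_state =
  sa_conf :: "'a \<Rightarrow> int"
  sa_queue :: "'a list"
  sa_fired :: "'a set"
  sa_left :: "'a \<Rightarrow> real"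
  sa_orient :: "'a rel"
  sa_blank :: "'a set set"

text \<open>
  \<open>place zs f J\<close> redefines \<open>J\<close> on the list \<open>zs\<close>, giving its \<open>i\<close>-th entry, counted from 1,
  the value \<open>f i\<close>.
\<close>

definition place :: "'a list \<Rightarrow> (nat \<Rightarrow> real) \<Rightarrow> ('a \<Rightarrow> real) \<Rightarrow> 'a \<Rightarrow> real" where
  "place zs f J =
     (\<lambda>v. case map_of (zip zs [1..<Suc (length zs)]) v of None \<Rightarrow> J v | Some i \<Rightarrow> f i)"

text \<open>
  In the following definitions \<open>xs\<close> is the vertex ordering; filtering it lists vertices in that order.
\<close>

definition sa_init ::
  "'a set \<Rightarrow> 'a set set \<Rightarrow> 'a list \<Rightarrow> ('a \<Rightarrow> int) \<Rightarrow> 'a sa_state" where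
  "sa_init V E xs c =
     (let b = (\<lambda>v. cmax V E v - c v);
          us = filter (unstable V E b) xs;
          k = length us
      in \<lparr>sa_conf = b, sa_queue = us, sa_fired = {},
          sa_left = place us (\<lambda>i. real i / real (k + 1)) (\<lambda>_. undefined),
          sa_orient = {}, sa_blank = {}\<rparr>)"

definition sa_step ::
  "'a set \<Rightarrow> 'a set set \<Rightarrow> 'a list \<Rightarrow> 'a sa_state \<Rightarrow> 'a sa_state" where
  "sa_step V E xs S =
     (let w = hd (sa_queue S);
          rest = tl (sa_queue S);
          \<alpha> = sa_left S w;
          \<epsilon> = (case rest of [] \<Rightarrow> 1 | w' # _ \<Rightarrow> sa_left S w' - \<alpha>);
          b = sa_conf S;
          b' = fire_vertex V E w b;
          fired' = insert w (sa_fired S);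
          zs = filter (\<lambda>z. z \<notin> fired' \<and> \<not> unstable V E b z \<and> unstable V E b' z) xs;
          t = length zs;
          undecided = {x. {w, x} \<in> E \<and> {w, x} \<notin> oriented_edges (sa_orient S) \<and>
                          {w, x} \<notin> sa_blank S}
      in \<lparr>sa_conf = b', sa_queue = rest @ zs, sa_fired = fired',
          sa_left = place zs (\<lambda>i. \<alpha> + 1 + real i * \<epsilon> / real (t + 1)) (sa_left S),
          sa_orient = sa_orient S \<union> {(w, x) | x. x \<in> undecided \<and> \<not> unstable V E b x},
          sa_blank = sa_blank S \<union> {{w, x} | x. x \<in> undecided \<and> unstable V E b x}\<rparr>)"

definition sa_run ::
  "'a set \<Rightarrow> 'a set set \<Rightarrow> 'a list \<Rightarrow> ('a \<Rightarrow> int) \<Rightarrow> 'a sa_state" where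
  "sa_run V E xs c = while (\<lambda>S. sa_queue S \<noteq> []) (sa_step V E xs) (sa_init V E xs c)"


section \<open>The maps\<close>

definition theta_map :: "'a set \<Rightarrow> 'a set set \<Rightarrow> 'a rel \<Rightarrow> 'a \<Rightarrow> int" where
  "theta_map V E P =
     (\<lambda>v. if v \<in> V then int (card {u \<in> V. (u, v) \<in> P \<and> {u, v} \<in> E}) - 1 else 0)"

definition psi_map :: "'a set \<Rightarrow> 'a rel \<Rightarrow> 'a \<Rightarrow> int" where
  "psi_map V R = (\<lambda>v. if v \<in> V then int (indegree R v) - 1 else 0)"

definition nu_map :: "'a set set \<Rightarrow> 'a rel \<Rightarrow> 'a rel" where
  "nu_map E P = {(u, w). {u, w} \<in> E \<and> (u, w) \<in> P}"

definition perms_upto :: "nat \<Rightarrow> (nat \<Rightarrow> nat) set" where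
  "perms_upto n = {\<sigma>. \<sigma> permutes {0..n}}"

definition vertex_order :: "(nat \<Rightarrow> 'a) \<Rightarrow> nat \<Rightarrow> (nat \<Rightarrow> nat) \<Rightarrow> 'a list" where
  "vertex_order v n \<sigma> = map (\<lambda>i. v (\<sigma> i)) [0..<Suc n]"

text \<open>The vertices are \<open>v 0, \<dots>, v n\<close>.\<close>

definition phi_map ::
  "'a set \<Rightarrow> 'a set set \<Rightarrow> (nat \<Rightarrow> 'a) \<Rightarrow> nat \<Rightarrow> ('a \<Rightarrow> int) \<times> (nat \<Rightarrow> nat) \<Rightarrow> 'a rel" where
  "phi_map V E v n = (\<lambda>(c, \<sigma>).
     let J = sa_left (sa_run V E (vertex_order v n \<sigma>) c)
     in {(u, w). u \<in> V \<and> w \<in> V \<and> J u + 1 < J w})"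

definition eta_map ::
  "'a set \<Rightarrow> 'a set set \<Rightarrow> (nat \<Rightarrow> 'a) \<Rightarrow> nat \<Rightarrow> ('a \<Rightarrow> int) \<times> (nat \<Rightarrow> nat) \<Rightarrow> 'a rel" where
  "eta_map V E v n = (\<lambda>(c, \<sigma>). sa_orient (sa_run V E (vertex_order v n \<sigma>) c))"

end

theory Submission
  imports Defs
begin

text \<open>
  A divisor counting incoming arcs of \<open>\<nu>(P)\<close> is quasi-superstable, because in any nonempty
  \<open>X\<close> the vertex with the leftmost interval receives arcs only from outside \<open>X\<close>. That
  \<open>\<nu>(P)\<close> is a semiorientation follows by adding up the differences of left endpoints around a
  cycle: they exceed \<open>1\<close> on oriented edges, are at least \<open>-1\<close> on blank ones, and sum to
  \<open>0\<close>. Conversely, the interval representations inducing a given semiorientation are the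
  solutions of a system of difference constraints, whose negative cycles are excluded by the
  condition on potential cycles; so \<open>\<nu>\<close> is onto, and with \<open>\<psi> \<circ> \<nu> = \<theta>\<close> this also gives
  \<open>\<psi>(\<O>) \<in> \<S>\<close>.

  In the algorithm a vertex \<open>v\<close> becomes unstable when exactly \<open>c v + 1\<close> of its neighbors
  have fired, and these are the tails of the arcs into \<open>v\<close>. If it stopped early, the unfired
  vertices would form a legal firing set.
\<close>

section \<open>Superstability on the cone\<close>

definition neighbors :: "'a set set \<Rightarrow> 'a \<Rightarrow> 'a set" where
  "neighbors E x = {y. {x, y} \<in> E}"

lemma simple_graph_edge:
  assumes "simple_graph V E" "{x, y} \<in> E"
  shows "x \<in> V" "y \<in> V" "x \<noteq> y"
  using assms unfolding simple_graph_def by (metis doubleton_eq_iff)+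

lemma simple_graph_no_loop: "simple_graph V E \<Longrightarrow> {x} \<notin> E"
  using simple_graph_edge(3)[of V E x x] by auto

lemma neighbors_subset: "simple_graph V E \<Longrightarrow> neighbors E x \<subseteq> V"
  by (auto simp: neighbors_def dest: simple_graph_edge)

lemma finite_neighbors: "simple_graph V E \<Longrightarrow> finite (neighbors E x)"
  using neighbors_subset finite_subset unfolding simple_graph_def by metis

lemma neighbors_sym: "y \<in> neighbors E x \<longleftrightarrow> x \<in> neighbors E y"
  by (simp add: neighbors_def insert_commute)

lemma not_neighbor_self: "simple_graph V E \<Longrightarrow> x \<notin> neighbors E x"
  using simple_graph_no_loop by (fastforce simp: neighbors_def)

lemma Some_edge_in_cone_edges: "{Some x, Some y} \<in> cone_edges V E \<longleftrightarrow> {x, y} \<in> E"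
proof
  assume "{Some x, Some y} \<in> cone_edges V E"
  then obtain e where e: "e \<in> E" "{Some x, Some y} = Some ` e"
    by (auto simp: cone_edges_def doubleton_eq_iff)
  from e(2) have "Some ` {x, y} = Some ` e" by simp
  then have "{x, y} = e" by (simp only: inj_image_eq_iff inj_Some)
  with e(1) show "{x, y} \<in> E" by simp
next
  assume "{x, y} \<in> E"
  then show "{Some x, Some y} \<in> cone_edges V E"
    unfolding cone_edges_def by (intro UnI1 image_eqI[of _ _ "{x, y}"]) auto
qed

lemma None_edge_in_cone_edges: "{Some x, None} \<in> cone_edges V E \<longleftrightarrow> x \<in> V"
  by (auto simp: cone_edges_def doubleton_eq_iff)

lemma cone_degree_eq:
  assumes "simple_graph V E" "x \<in> V"
  shows "cone_degree V E x = Suc (card (neighbors E x))"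
proof -
  have "y \<in> insert None (Some ` neighbors E x)" if "{Some x, y} \<in> cone_edges V E" for y
    using that by (cases y) (auto simp: Some_edge_in_cone_edges neighbors_def)
  then have "{y. {Some x, y} \<in> cone_edges V E} = insert None (Some ` neighbors E x)"
    using assms(2) by (auto simp: Some_edge_in_cone_edges None_edge_in_cone_edges neighbors_def)
  then show ?thesis
    using finite_neighbors[OF assms(1)]
    by (simp add: cone_degree_def graph_degree_def card_image)
qed

text \<open>In row \<open>Some x\<close> of the reduced Laplacian the diagonal entry is the degree
  in the graph plus one for the edge to the sink, paid only if \<open>x\<close> fires. Each fired
  neighbor gives one grain back.\<close>

lemma fire_set_cone:
  assumes "simple_graph V E" "x \<in> V" "X \<subseteq> V"
  shows "fire_set (cone_verts V) (cone_edges V E) None (Some ` X) c (Some x) =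
    c (Some x) + int (card (neighbors E x \<inter> X))
      - (if x \<in> X then int (card (neighbors E x)) + 1 else 0)"
proof -
  have fin: "finite V" using assms(1) by (simp add: simple_graph_def)
  have cv: "cone_verts V - {None} = Some ` V" by (auto simp: cone_verts_def)
  have deg: "int (graph_degree (cone_edges V E) (Some x)) = int (card (neighbors E x)) + 1"
    using cone_degree_eq[OF assms(1,2)] by (simp add: cone_degree_def)
  have "(\<Sum>y\<in>cone_verts V - {None}. laplacian (cone_edges V E) (Some x) y * of_bool (y \<in> Some ` X))
      = (\<Sum>y\<in>V. laplacian (cone_edges V E) (Some x) (Some y) * of_bool (y \<in> X))"
    unfolding cv by (subst sum.reindex) (auto simp: image_iff)
  also have "\<dots> = (\<Sum>y\<in>V. (if x = y then (if x \<in> X then int (card (neighbors E x)) + 1 else 0) else 0)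
        - (if y \<in> neighbors E x \<inter> X then 1 else 0))"
    by (intro sum.cong)
      (auto simp: laplacian_def Some_edge_in_cone_edges deg neighbors_def)
  also have "\<dots> = (if x \<in> X then int (card (neighbors E x)) + 1 else 0)
      - (\<Sum>y\<in>V. if y \<in> neighbors E x \<inter> X then 1 else 0)"
    using fin assms(2) by (simp add: sum_subtractf)
  also have "(\<Sum>y\<in>V. if y \<in> neighbors E x \<inter> X then 1 else 0 :: int) =
      int (card (V \<inter> (neighbors E x \<inter> X)))"
    using fin by (subst sum.inter_restrict[symmetric]) auto
  also have "V \<inter> (neighbors E x \<inter> X) = neighbors E x \<inter> X"
    using assms(3) by auto
  finally show ?thesis by (simp add: fire_set_def)
qed

text \<open>Serves to replace firing sets of nonsink vertices of the cone by subsets of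
  \<open>V\<close>.\<close>

lemma nonempty_subset_image_ex:
  "(\<exists>Y. Y \<noteq> {} \<and> Y \<subseteq> f ` A \<and> Q Y) \<longleftrightarrow> (\<exists>X. X \<noteq> {} \<and> X \<subseteq> A \<and> Q (f ` X))"
proof
  assume "\<exists>Y. Y \<noteq> {} \<and> Y \<subseteq> f ` A \<and> Q Y"
  then obtain X where "X \<subseteq> A" "f ` X \<noteq> {}" "Q (f ` X)" by (auto simp: subset_image_iff)
  then show "\<exists>X. X \<noteq> {} \<and> X \<subseteq> A \<and> Q (f ` X)" by blast
next
  assume "\<exists>X. X \<noteq> {} \<and> X \<subseteq> A \<and> Q (f ` X)"
  then obtain X where "X \<noteq> {}" "X \<subseteq> A" "Q (f ` X)" by blast
  then show "\<exists>Y. Y \<noteq> {} \<and> Y \<subseteq> f ` A \<and> Q Y" by (intro exI[of _ "f ` X"]) auto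
qed

text \<open>Once \<open>c + 1\<close> is nonnegative, firing \<open>X\<close> can make only members
  of \<open>X\<close> negative. Such an \<open>x\<close> loses one grain to the sink and one to each
  neighbor outside \<open>X\<close>, so it goes negative exactly when
  \<open>c x < card (neighbors E x - X)\<close>.\<close>

lemma quasi_superstables_iff:
  assumes "simple_graph V E"
  shows "c \<in> quasi_superstables V E \<longleftrightarrow>
    c \<in> divisors V \<and> (\<forall>x\<in>V. 0 \<le> c x + 1) \<and>
    (\<forall>X. X \<noteq> {} \<longrightarrow> X \<subseteq> V \<longrightarrow> (\<exists>x\<in>X. c x + 1 \<le> int (card (neighbors E x - X))))"
proof -
  let ?c = "\<lambda>x. case x of None \<Rightarrow> 0 | Some v \<Rightarrow> c v + 1"
  have cv: "cone_verts V - {None} = Some ` V" by (auto simp: cone_verts_def)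
  define legal where "legal X \<longleftrightarrow>
    (\<forall>x\<in>Some ` V. 0 \<le> fire_set (cone_verts V) (cone_edges V E) None (Some ` X) ?c x)" for X
  have sets: "(\<exists>Y. Y \<noteq> {} \<and> Y \<subseteq> Some ` V \<and>
      (\<forall>x\<in>Some ` V. 0 \<le> fire_set (cone_verts V) (cone_edges V E) None Y ?c x)) \<longleftrightarrow>
      (\<exists>X. X \<noteq> {} \<and> X \<subseteq> V \<and> legal X)"
    unfolding legal_def by (rule nonempty_subset_image_ex)
  have legal: "legal X \<longleftrightarrow> \<not> (\<exists>x\<in>X. c x + 1 \<le> int (card (neighbors E x - X)))"
    if X: "X \<subseteq> V" and nn: "\<forall>x\<in>V. 0 \<le> c x + 1" for X
  proof -
    have "card (neighbors E x) = card (neighbors E x \<inter> X) + card (neighbors E x - X)" for x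
      using finite_neighbors[OF assms] by (metis card_Int_Diff)
    then have "0 \<le> fire_set (cone_verts V) (cone_edges V E) None (Some ` X) ?c (Some x) \<longleftrightarrow>
        (x \<in> X \<longrightarrow> \<not> c x + 1 \<le> int (card (neighbors E x - X)))" if "x \<in> V" for x
      using fire_set_cone[OF assms that X, of ?c] nn that by (auto simp: not_le)
    then show ?thesis using X by (auto simp: legal_def)
  qed
  have nonneg: "(\<forall>x\<in>Some ` V. 0 \<le> ?c x) \<longleftrightarrow> (\<forall>x\<in>V. 0 \<le> c x + 1)" by simp
  show ?thesis
    unfolding quasi_superstables_def superstable_def cv mem_Collect_eq sets nonneg
    using legal by blast
qed


section \<open>Cycles\<close>

definition cycle_edge :: "'a list \<Rightarrow> nat \<Rightarrow> 'a set" where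
  "cycle_edge c i = {c ! i, c ! (Suc i mod length c)}"

lemma cycle_edges_eq_image: "cycle_edges c = cycle_edge c ` {..<length c}"
  by (auto simp: cycle_edges_def cycle_arcs_def cycle_edge_def)

text \<open>Two opposite arcs would make \<open>i\<close> and \<open>j\<close> cyclic successors of
  each other, which forces the length to divide 2.\<close>

lemma cycle_arc_asym:
  assumes "distinct c" "3 \<le> length c" "i < length c" "j < length c"
    and "c ! i = c ! (Suc j mod length c)" "c ! j = c ! (Suc i mod length c)"
  shows False
proof -
  have "Suc i mod length c < length c" "Suc j mod length c < length c"
    using assms(3) by (auto intro!: mod_less_divisor)
  then have "i = Suc j mod length c" "j = Suc i mod length c"
    using assms by (metis nth_eq_iff_index_eq)+
  then have "Suc j = length c \<and> i = 0 \<or> i = Suc j" "Suc i = length c \<and> j = 0 \<or> j = Suc i"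
    using assms(3,4) by (metis Suc_lessI mod_less mod_self)+
  then show False using assms(2) by (elim disjE conjE) linarith+
qed

lemma inj_on_cycle_edge:
  assumes "distinct c" "3 \<le> length c"
  shows "inj_on (cycle_edge c) {..<length c}"
proof (rule inj_onI)
  fix i j assume ij: "i \<in> {..<length c}" "j \<in> {..<length c}" "cycle_edge c i = cycle_edge c j"
  then have "c ! i = c ! j \<or> c ! i = c ! (Suc j mod length c) \<and> c ! j = c ! (Suc i mod length c)"
    by (auto simp: cycle_edge_def doubleton_eq_iff)
  then show "i = j"
    using cycle_arc_asym[OF assms] ij(1,2) assms(1) by (auto simp: nth_eq_iff_index_eq)
qed

text \<open>Distinct positions carry distinct edges, so edges may be counted by positions, over
  which the sums around a cycle run.\<close>

lemma card_cycle_edges_split: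
  assumes "distinct c" "3 \<le> length c"
  shows "card (cycle_edges c \<inter> D) = card {i. i < length c \<and> cycle_edge c i \<in> D}"
    and "card (cycle_edges c - D) = card {i. i < length c \<and> cycle_edge c i \<notin> D}"
proof -
  note inj = inj_on_subset[OF inj_on_cycle_edge[OF assms]]
  have "cycle_edges c \<inter> D = cycle_edge c ` {i. i < length c \<and> cycle_edge c i \<in> D}"
    "cycle_edges c - D = cycle_edge c ` {i. i < length c \<and> cycle_edge c i \<notin> D}"
    by (auto simp: cycle_edges_eq_image)
  then show "card (cycle_edges c \<inter> D) = card {i. i < length c \<and> cycle_edge c i \<in> D}"
    "card (cycle_edges c - D) = card {i. i < length c \<and> cycle_edge c i \<notin> D}"
    by (auto intro!: card_image inj)
qed

text \<open>With \<open>m = length c\<close>, arc \<open>i\<close> of the reversed list is arc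
  \<open>m - 2 - i\<close> of \<open>c\<close> traversed backwards. The closing arc
  \<open>i = m - 1\<close> corresponds to the closing arc of \<open>c\<close>.\<close>

lemma cycle_arcs_rev_subset: "cycle_arcs (rev c) \<subseteq> (cycle_arcs c)\<inverse>"
proof
  fix p assume "p \<in> cycle_arcs (rev c)"
  then obtain i where i: "i < length c" "p = (rev c ! i, rev c ! (Suc i mod length c))"
    by (auto simp: cycle_arcs_def)
  show "p \<in> (cycle_arcs c)\<inverse>"
  proof (cases "Suc i = length c")
    case True
    have "0 < length c" using i(1) by linarith
    then have "rev c ! 0 = c ! (length c - 1)" by (simp add: rev_nth)
    moreover have "rev c ! i = c ! 0" using i(1) True by (simp add: rev_nth)
    moreover have "Suc (length c - 1) mod length c = 0" using True by (metis diff_Suc_1 mod_self)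
    ultimately have "p = (c ! (Suc (length c - 1) mod length c), c ! (length c - 1))"
      using i(2) True by simp
    then show ?thesis using i(1) unfolding cycle_arcs_def by (auto intro!: exI[of _ "length c - 1"])
  next
    case False
    then have *: "Suc (length c - Suc (Suc i)) = length c - Suc i" using i(1) by simp
    have "p = (c ! (Suc (length c - Suc (Suc i)) mod length c), c ! (length c - Suc (Suc i)))"
      unfolding * using i False by (auto simp: rev_nth)
    then show ?thesis using i(1) unfolding cycle_arcs_def
      by (auto intro!: exI[of _ "length c - Suc (Suc i)"])
  qed
qed

lemma cycle_edges_rev: "cycle_edges (rev c) = cycle_edges c"
proof -
  have "cycle_edges (rev c) \<subseteq> cycle_edges c" for c :: "'a list"
    using cycle_arcs_rev_subset[of c] by (fastforce simp: cycle_edges_def insert_commute)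
  from this[of c] this[of "rev c"] show ?thesis by simp
qed

text \<open>The reason why successive differences around a cycle add up to 0.\<close>

lemma sum_rotate_index:
  fixes g :: "nat \<Rightarrow> 'b::ab_group_add"
  shows "(\<Sum>i<m. g (Suc i mod m)) = (\<Sum>i<m. g i)"
proof (cases m)
  case (Suc k)
  have "(\<Sum>i<Suc k. g (Suc i mod Suc k)) = (\<Sum>i<k. g (Suc i)) + g 0"
    by simp
  then show ?thesis unfolding Suc by (simp add: sum.lessThan_Suc_shift add.commute del: sum.lessThan_Suc)
qed simp

text \<open>Since \<open>R'\<close> contains \<open>(x, y)\<close>, it excludes
  \<open>(y, x)\<close>; hence \<open>R\<close> can orient this edge in one way only. Oriented edges
  of a directed cycle can thus be counted as arcs in \<open>R\<close>.\<close>

lemma partial_orientation_arc_iff: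
  assumes "partial_orientation V E R'" "R \<subseteq> R'" "(x, y) \<in> R'"
  shows "{x, y} \<in> oriented_edges R \<longleftrightarrow> (x, y) \<in> R"
  using assms by (auto simp: partial_orientation_def oriented_edges_def doubleton_eq_iff)


section \<open>From semiorders to semiorientations and divisors\<close>

lemma nu_map_semiorientation:
  assumes G: "simple_graph V E" and P: "P \<in> semiorders V"
  shows "nu_map E P \<in> semiorientations V E"
proof -
  let ?R = "nu_map E P"
  obtain a :: "'a \<Rightarrow> real" where
    a: "\<And>u w. u \<in> V \<Longrightarrow> w \<in> V \<Longrightarrow> (u, w) \<in> P \<longleftrightarrow> a u + 1 < a w"
    using P by (auto simp: semiorders_def)
  have R: "(u, w) \<in> ?R \<longleftrightarrow> {u, w} \<in> E \<and> a u + 1 < a w" for u w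
    using a simple_graph_edge[OF G] by (auto simp: nu_map_def)
  have po: "partial_orientation V E ?R"
    using R simple_graph_edge[OF G] by (force simp: partial_orientation_def)
  \<comment> \<open>One direction of traversal suffices: a potential cycle directed the other way is
    handled by \<open>rev c\<close>, which has the same edges.\<close>
  have directed: "card (cycle_edges c \<inter> oriented_edges ?R) < card (cycle_edges c - oriented_edges ?R)"
    if c: "distinct c" "3 \<le> length c" "cycle_edges c \<subseteq> E"
      and R': "partial_orientation V E R'" "?R \<subseteq> R'" "cycle_arcs c \<subseteq> R'" for c R'
  proof -
    let ?m = "length c"
    let ?d = "\<lambda>i. a (c ! (Suc i mod ?m)) - a (c ! i)"
    let ?I = "{i. i < ?m \<and> cycle_edge c i \<in> oriented_edges ?R}"
    let ?B = "{i. i < ?m \<and> cycle_edge c i \<notin> oriented_edges ?R}"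
    have up: "?d i > 1" if "i \<in> ?I" for i
    proof -
      have "(c ! i, c ! (Suc i mod ?m)) \<in> R'" using that R'(3) by (auto simp: cycle_arcs_def)
      then have "(c ! i, c ! (Suc i mod ?m)) \<in> ?R"
        using that partial_orientation_arc_iff[OF R'(1,2)] by (auto simp: cycle_edge_def)
      then show ?thesis by (simp add: R)
    qed
    \<comment> \<open>A drop by more than 1 would orient the edge backwards, so it would not be
      blank.\<close>
    have down: "?d i \<ge> -1" if "i \<in> ?B" for i
    proof (rule ccontr)
      assume "\<not> ?thesis"
      moreover have "{c ! (Suc i mod ?m), c ! i} \<in> E"
        using that c(3) by (auto simp: cycle_edges_eq_image cycle_edge_def insert_commute)
      ultimately have "(c ! (Suc i mod ?m), c ! i) \<in> ?R" by (simp add: R)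
      then show False using that by (auto simp: cycle_edge_def oriented_edges_def insert_commute)
    qed
    have total: "(\<Sum>i\<in>?I. ?d i) + (\<Sum>i\<in>?B. ?d i) = 0"
    proof -
      have "(\<Sum>i\<in>?I. ?d i) + (\<Sum>i\<in>?B. ?d i) = (\<Sum>i<?m. ?d i)"
        by (subst sum.union_disjoint[symmetric]) (auto intro!: sum.cong)
      also have "\<dots> = 0"
        using sum_rotate_index[of "\<lambda>i. a (c ! i)" ?m] by (simp add: sum_subtractf)
      finally show ?thesis .
    qed
    have B: "(\<Sum>i\<in>?B. ?d i) \<ge> - real (card ?B)"
      using sum_mono[of ?B "\<lambda>_. -1" ?d] down by simp
    have "card ?I < card ?B"
    \<comment> \<open>The strict inequality comes from the oriented edges; if there are none, all of
      the at least three edges are blank.\<close>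
    proof (cases "?I = {}")
      case True
      then have "card ?I = 0" by (simp only: card.empty)
      moreover have "?B = {..<?m}" using True by auto
      then have "card ?B = ?m" by (simp only: card_lessThan)
      ultimately show ?thesis using c(2) by linarith
    next
      case False
      have "(\<Sum>i\<in>?I. ?d i) > real (card ?I)"
        using sum_strict_mono[OF _ False, of "\<lambda>_. 1" ?d] up by simp
      then show ?thesis using total B by linarith
    qed
    then show ?thesis by (simp add: card_cycle_edges_split c)
  qed
  have "card (cycle_edges c \<inter> oriented_edges ?R) < card (cycle_edges c - oriented_edges ?R)"
    if "potential_cycle V E ?R c" for c
  proof -
    from that obtain R' where c: "graph_cycle E c"
      and R': "partial_orientation V E R'" "?R \<subseteq> R'"
        "cycle_arcs c \<subseteq> R' \<or> cycle_arcs (rev c) \<subseteq> R'"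
      by (auto simp: potential_cycle_def)
    then show ?thesis
      using directed[of c R'] directed[of "rev c" R']
      by (auto simp: graph_cycle_def cycle_edges_rev)
  qed
  then show ?thesis using po by (simp add: semiorientations_def)
qed

lemma psi_map_nu_map:
  assumes "simple_graph V E"
  shows "psi_map V (nu_map E P) = theta_map V E P"
proof -
  have "{u. (u, v) \<in> nu_map E P} = {u \<in> V. (u, v) \<in> P \<and> {u, v} \<in> E}" for v
    using simple_graph_edge[OF assms] by (auto simp: nu_map_def)
  then show ?thesis by (auto simp: psi_map_def theta_map_def indegree_def)
qed

lemma theta_map_quasi_superstable:
  assumes G: "simple_graph V E" and P: "P \<in> semiorders V"
  shows "theta_map V E P \<in> quasi_superstables V E"
proof -
  obtain a :: "'a \<Rightarrow> real" where
    a: "\<And>u w. u \<in> V \<Longrightarrow> w \<in> V \<Longrightarrow> (u, w) \<in> P \<longleftrightarrow> a u + 1 < a w"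
    using P by (auto simp: semiorders_def)
  have "\<exists>x\<in>X. theta_map V E P x + 1 \<le> int (card (neighbors E x - X))"
    if X: "X \<noteq> {}" "X \<subseteq> V" for X
  proof -
    have "finite X" using X(2) G by (auto simp: simple_graph_def intro: finite_subset)
    then obtain x where x: "x \<in> X" "\<And>y. y \<in> X \<Longrightarrow> a x \<le> a y"
      using X(1) ex_min_if_finite[of "a ` X"] by (fastforce simp: not_less)
    have "{u \<in> V. (u, x) \<in> P \<and> {u, x} \<in> E} \<subseteq> neighbors E x - X"
      using a x X(2) by (force simp: neighbors_def insert_commute)
    then have "card {u \<in> V. (u, x) \<in> P \<and> {u, x} \<in> E} \<le> card (neighbors E x - X)"
      by (intro card_mono) (auto intro: finite_neighbors[OF G])
    then show ?thesis using x(1) X(2) by (intro bexI[of _ x]) (auto simp: theta_map_def)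
  qed
  then show ?thesis
    by (simp add: quasi_superstables_iff[OF G]) (auto simp: divisors_def theta_map_def)
qed


section \<open>Potentials of weighted digraphs without negative cycles\<close>

fun walk_weight :: "('a \<Rightarrow> 'a \<Rightarrow> int) \<Rightarrow> 'a list \<Rightarrow> int" where
  "walk_weight W (x # y # xs) = W x y + walk_weight W (y # xs)"
| "walk_weight W _ = 0"

lemma walk_weight_split:
  "walk_weight W (xs @ y # ys) = walk_weight W (xs @ [y]) + walk_weight W (y # ys)"
proof (induction xs)
  case (Cons x xs)
  then show ?case by (cases xs) auto
qed simp

lemma walk_weight_snoc:
  "xs \<noteq> [] \<Longrightarrow> walk_weight W (xs @ [y]) = walk_weight W xs + W (last xs) y"
proof (induction xs)
  case (Cons x xs)
  then show ?case by (cases xs) auto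
qed simp

lemma walk_weight_eq_sum: "walk_weight W (x # xs) = (\<Sum>i<length xs. W ((x # xs) ! i) (xs ! i))"
proof (induction xs arbitrary: x)
  case (Cons y ys)
  show ?case by (simp add: Cons sum.lessThan_Suc_shift del: sum.lessThan_Suc)
qed simp

text \<open>Reducing the index modulo the length turns the closing arc into the last
  summand.\<close>

lemma closed_walk_weight_eq_sum:
  assumes "c \<noteq> []"
  shows "walk_weight W c + W (last c) (hd c) = (\<Sum>i<length c. W (c ! i) (c ! (Suc i mod length c)))"
proof -
  obtain x xs where c: "c = x # xs" using assms by (cases c) auto
  have "walk_weight W c = (\<Sum>i<length xs. W (c ! i) (c ! (Suc i mod length c)))"
    unfolding c walk_weight_eq_sum by (intro sum.cong) auto
  then show ?thesis by (simp add: c last_conv_nth)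
qed

text \<open>The potential of a vertex is the least weight of a simple path ending there.\<close>

lemma ex_potential:
  fixes W :: "'a \<Rightarrow> 'a \<Rightarrow> int"
  assumes fin: "finite V" and AV: "\<And>x y. A x y \<Longrightarrow> x \<in> V \<and> y \<in> V"
    and cyc: "\<And>c. c \<noteq> [] \<Longrightarrow> distinct c \<Longrightarrow> set c \<subseteq> V \<Longrightarrow> successively A c \<Longrightarrow> A (last c) (hd c)
      \<Longrightarrow> 0 \<le> walk_weight W c + W (last c) (hd c)"
  shows "\<exists>h. \<forall>x y. A x y \<longrightarrow> h y \<le> h x + W x y"
proof -
  define paths where
    "paths x = {p. p \<noteq> [] \<and> distinct p \<and> set p \<subseteq> V \<and> successively A p \<and> last p = x}" for x
  define h where "h x = Min (walk_weight W ` paths x)" for x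
  have finp: "finite (paths x)" for x
    by (rule finite_subset[OF _ finite_subset_distinct[OF fin]]) (auto simp: paths_def)
  have h_le: "h x \<le> walk_weight W p" if "p \<in> paths x" for x p
    unfolding h_def using that finp by (intro Min_le) auto
  have "h y \<le> h x + W x y" if xy: "A x y" for x y
  proof -
    \<comment> \<open>Paths may start anywhere, so the one-vertex path shows that the minimum is
      over a nonempty set and is attained.\<close>
    have "[x] \<in> paths x" using AV[OF xy] by (simp add: paths_def)
    then have "h x \<in> walk_weight W ` paths x"
      unfolding h_def using finp by (intro Min_in) auto
    then obtain p where p: "p \<in> paths x" "h x = walk_weight W p" by auto
    show ?thesis
    proof (cases "y \<in> set p")
      case False
      then have "p @ [y] \<in> paths y"
        using p(1) xy AV[OF xy] by (auto simp: paths_def successively_append_iff)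
      from h_le[OF this] show ?thesis
        using p by (simp add: walk_weight_snoc paths_def)
    next
      case True
      \<comment> \<open>Appending \<open>y\<close> would close the cycle \<open>y # s\<close>. Its
        weight including the arc from \<open>x\<close> to \<open>y\<close> is nonnegative, so
        cutting \<open>p\<close> off at \<open>y\<close> gives a path of weight at most
        \<open>h x + W x y\<close>.\<close>
      then obtain r s where rs: "p = r @ y # s" by (meson split_list)
      then have "r @ [y] \<in> paths y"
        using p(1) by (auto simp: paths_def successively_append_iff)
      then have "h y \<le> walk_weight W (r @ [y])" by (rule h_le)
      moreover have "0 \<le> walk_weight W (y # s) + W (last (y # s)) (hd (y # s))"
        using p(1) xy rs by (intro cyc) (auto simp: paths_def successively_append_iff)
      moreover have "last (y # s) = x" using p(1) rs by (simp add: paths_def)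
      ultimately show ?thesis using p(2) rs walk_weight_split[of W r y s] by simp
    qed
  qed
  then show ?thesis by blast
qed


section \<open>Every semiorientation comes from a semiorder\<close>

text \<open>\<open>R\<close> together with all arcs of \<open>c\<close> is still a partial
  orientation: no arc of \<open>c\<close> is opposite to one of \<open>R\<close> or to another arc
  of \<open>c\<close>. This extension witnesses that \<open>c\<close> is a potential cycle.\<close>

lemma semiorientation_potential_cycle:
  assumes G: "simple_graph V E" and R: "R \<in> semiorientations V E"
    and c: "3 \<le> length c" "distinct c"
    and arcs: "\<And>x y. (x, y) \<in> cycle_arcs c \<Longrightarrow> {x, y} \<in> E \<and> (y, x) \<notin> R"
  shows "card {i. i < length c \<and> (c ! i, c ! (Suc i mod length c)) \<in> R}
    < card {i. i < length c \<and> (c ! i, c ! (Suc i mod length c)) \<notin> R}"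
proof -
  have po: "partial_orientation V E R" using R by (simp add: semiorientations_def)
  have "(y, x) \<notin> cycle_arcs c" if "(x, y) \<in> cycle_arcs c" for x y
    using that cycle_arc_asym[OF c(2,1)] by (fastforce simp: cycle_arcs_def)
  then have po': "partial_orientation V E (R \<union> cycle_arcs c)"
    using po arcs simple_graph_edge[OF G] unfolding partial_orientation_def by fast
  have "graph_cycle E c"
    using c arcs by (auto simp: graph_cycle_def cycle_edges_def)
  with po' have "potential_cycle V E R c" by (auto simp: potential_cycle_def)
  then have "card (cycle_edges c \<inter> oriented_edges R) < card (cycle_edges c - oriented_edges R)"
    using R by (simp add: semiorientations_def)
  moreover have "cycle_edge c i \<in> oriented_edges R \<longleftrightarrow> (c ! i, c ! (Suc i mod length c)) \<in> R"
    if "i < length c" for i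
    unfolding cycle_edge_def
    using that by (intro partial_orientation_arc_iff[OF po']) (auto simp: cycle_arcs_def)
  ultimately show ?thesis
    by (simp add: card_cycle_edges_split c cong: conj_cong)
qed

text \<open>
  The left endpoints have to satisfy strict lower bounds \<open>a u + 1 < a w\<close> on oriented edges and
  \<open>\<bar>a u - a w\<bar> \<le> 1\<close> on blank ones. Scaled by \<open>N = card V\<close> they can be
  tightened to the integral bounds \<open>N + 1\<close> and \<open>N - 1\<close>, because a potential cycle has at most
  \<open>N\<close> edges, and the slack gained makes room for a perturbation to an injective function.
\<close>

lemma nu_map_surj:
  assumes G: "simple_graph V E" and R: "R \<in> semiorientations V E"
  shows "\<exists>P\<in>semiorders V. nu_map E P = R"
proof -
  have fin: "finite V" using G by (simp add: simple_graph_def)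
  have po: "R \<subseteq> V \<times> V" "\<And>u w. (u, w) \<in> R \<Longrightarrow> {u, w} \<in> E" "\<And>u w. (u, w) \<in> R \<Longrightarrow> (w, u) \<notin> R"
    using R by (auto simp: semiorientations_def partial_orientation_def)
  define N where "N = int (card V)"
  define A where "A x y \<longleftrightarrow> {x, y} \<in> E \<and> (y, x) \<notin> R" for x y
  \<comment> \<open>The potential will be minus the scaled left endpoint: \<open>- h\<close> rises
    by at least \<open>N + 1\<close> along an oriented arc and falls by at most \<open>N - 1\<close>
    along a blank edge.\<close>
  define W where "W x y = (if (x, y) \<in> R then - (N + 1) else N - 1)" for x y
  have AV: "x \<in> V \<and> y \<in> V" if "A x y" for x y
    using that simple_graph_edge[OF G] by (auto simp: A_def)
  have "0 \<le> walk_weight W c + W (last c) (hd c)"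
    if c: "c \<noteq> []" "distinct c" "set c \<subseteq> V" "successively A c" "A (last c) (hd c)" for c
  proof -
    let ?m = "length c"
    have arc: "A (c ! i) (c ! (Suc i mod ?m))" if "i < ?m" for i
    proof (cases "Suc i = ?m")
      case True
      then have "c ! i = last c" using c(1) by (metis last_conv_nth diff_Suc_1)
      then show ?thesis using True c by (simp add: hd_conv_nth)
    next
      case False
      then show ?thesis using that c(4) by (simp add: successively_conv_nth)
    qed
    have mN: "int ?m \<le> N"
      unfolding N_def using c(2,3) fin by (metis card_mono distinct_card of_nat_le_iff)
    have "0 < ?m" using c(1) by simp
    then consider "?m = 1" | "?m = 2" | "3 \<le> ?m" by linarith
    then show ?thesis
    proof cases
      case 1
      then have "A (c ! 0) (c ! 0)" using arc[of 0] by simp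
      then show ?thesis using simple_graph_no_loop[OF G] by (simp add: A_def)
    next
      \<comment> \<open>Both directions are admissible, so the edge is blank and the weight is
        \<open>2 * (N - 1)\<close>. Cycles in the graph have length at least 3, so the condition on
        potential cycles does not cover this case.\<close>
      case 2
      then obtain x y where xy: "c = [x, y]" by (auto simp: numeral_eq_Suc length_Suc_conv)
      then show ?thesis using c(4,5) mN by (auto simp: A_def W_def)
    next
      case 3
      let ?I = "{i. i < ?m \<and> (c ! i, c ! (Suc i mod ?m)) \<in> R}"
      let ?B = "{i. i < ?m \<and> (c ! i, c ! (Suc i mod ?m)) \<notin> R}"
      have lt: "card ?I < card ?B"
        using arc by (intro semiorientation_potential_cycle[OF G R 3 c(2)])
          (auto simp: cycle_arcs_def A_def)
      have "?I \<union> ?B = {..<?m}" by auto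
      then have split: "card ?I + card ?B = ?m"
        by (subst card_Un_disjoint[symmetric]) auto
      have "walk_weight W c + W (last c) (hd c) = (\<Sum>i\<in>?I \<union> ?B. W (c ! i) (c ! (Suc i mod ?m)))"
        unfolding closed_walk_weight_eq_sum[OF c(1)] by (intro sum.cong) auto
      also have "\<dots> = (\<Sum>i\<in>?I. - (N + 1)) + (\<Sum>i\<in>?B. N - 1)"
        by (subst sum.union_disjoint) (auto simp: W_def)
      also have "\<dots> = N * (int (card ?B) - int (card ?I)) - (int (card ?I) + int (card ?B))"
        by (simp add: algebra_simps)
      finally have eq: "walk_weight W c + W (last c) (hd c) =
        N * (int (card ?B) - int (card ?I)) - (int (card ?I) + int (card ?B))" .
      \<comment> \<open>The surplus of blank edges contributes at least \<open>N\<close>, which pays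
        for the length of the cycle.\<close>
      have "N * 1 \<le> N * (int (card ?B) - int (card ?I))"
        using lt by (intro mult_left_mono) (auto simp: N_def)
      then show ?thesis using eq mN split by linarith
    qed
  qed
  then obtain h where h: "\<And>x y. A x y \<Longrightarrow> h y \<le> h x + W x y"
    using ex_potential[OF fin, of A W] AV by blast
  obtain f :: "'a \<Rightarrow> nat" where f: "bij_betw f V {0..<card V}"
    using ex_bij_betw_finite_nat[OF fin] by blast
  \<comment> \<open>The terms \<open>f x / N\<close> are distinct numbers in [0, 1). They separate
    vertices with equal \<open>h\<close> and differ by less than the slack 1 in the integral
    bounds.\<close>
  define a :: "'a \<Rightarrow> real" where "a x = (f x / N - h x) / N" for x
  have fN: "real (f x) / N < 1" "0 \<le> real (f x) / N" "N > 0" if "x \<in> V" for x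
  proof -
    have "f x < card V" using bij_betwE[OF f] that by simp
    then show "real (f x) / N < 1" "0 \<le> real (f x) / N" "N > 0" by (simp_all add: N_def)
  qed
  have "inj_on a V"
  proof (rule inj_onI)
    fix x y assume xy: "x \<in> V" "y \<in> V" "a x = a y"
    then have eq: "f x / N - h x = f y / N - h y"
      using fN(3)[of x] by (simp add: a_def)
    then have "real_of_int (h x - h y) = f x / N - f y / N" by simp
    then have "\<bar>real_of_int (h x - h y)\<bar> < 1"
      using fN[of x] fN[of y] xy by linarith
    then have "h x = h y" by linarith
    then have "f x = f y" using eq fN(3)[OF xy(1)] by simp
    then show "x = y" using f xy by (auto simp: bij_betw_def inj_on_def)
  qed
  moreover have orient: "(u, w) \<in> R \<longleftrightarrow> a u + 1 < a w" if e: "{u, w} \<in> E" for u w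
  proof -
    note uw = simple_graph_edge(1,2)[OF G e]
    have a1: "a u + 1 < a w \<longleftrightarrow> f u / N - h u + N < f w / N - h w"
    proof -
      have "a u + 1 < a w \<longleftrightarrow> (a u + 1) * N < a w * N"
        using fN(3)[OF uw(1)] by (simp only: mult_less_cancel_right_pos of_int_0_less_iff)
      moreover have "a u * N = f u / N - h u" "a w * N = f w / N - h w"
        using fN(3)[OF uw(1)] by (simp_all add: a_def)
      ultimately show ?thesis by (simp only: distrib_right mult_1)
    qed
    show ?thesis
    proof
      assume "(u, w) \<in> R"
      then have "h w \<le> h u - (N + 1)" using h[of u w] e po(3) by (auto simp: A_def W_def)
      then have "real_of_int (h w) \<le> h u - (N + 1)" by linarith
      then show "a u + 1 < a w" using fN[OF uw(1)] fN[OF uw(2)] unfolding a1 by linarith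
    next
      assume lt: "a u + 1 < a w"
      show "(u, w) \<in> R"
      proof (rule ccontr)
        assume n: "(u, w) \<notin> R"
        \<comment> \<open>The arc from \<open>w\<close> to \<open>u\<close> is admissible whether
          the edge is blank or oriented from \<open>w\<close> to \<open>u\<close>, and either weight
          is at most \<open>N - 1\<close>.\<close>
        then have "h u \<le> h w + W w u" using h[of w u] e by (auto simp: A_def insert_commute)
        also have "\<dots> \<le> h w + N - 1" using fN(3)[OF uw(1)] by (simp add: W_def)
        finally have "real_of_int (h u) \<le> h w + N - 1" by linarith
        then show False using fN[OF uw(1)] fN[OF uw(2)] lt unfolding a1 by linarith
      qed
    qed
  qed
  ultimately have "{(u, w). u \<in> V \<and> w \<in> V \<and> a u + 1 < a w} \<in> semiorders V"
    by (auto simp: semiorders_def)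
  moreover have "nu_map E {(u, w). u \<in> V \<and> w \<in> V \<and> a u + 1 < a w} = R"
    unfolding nu_map_def using orient po(2) simple_graph_edge(1,2)[OF G] by blast
  ultimately show ?thesis by blast
qed


section \<open>Correctness of the superstables algorithm\<close>

lemma place_nth:
  "distinct zs \<Longrightarrow> i < length zs \<Longrightarrow> place zs f J (zs ! i) = f (Suc i)"
  by (simp add: place_def map_of_zip_nth del: upt_Suc)

lemma place_notin: "x \<notin> set zs \<Longrightarrow> place zs f J x = J x"
proof -
  assume "x \<notin> set zs"
  then have "map_of (zip zs [1..<Suc (length zs)]) x = None"
    by (subst map_of_zip_is_None) (simp_all del: upt_Suc)
  then show ?thesis unfolding place_def by (simp only: option.case)
qed

lemma place_in:
  assumes "distinct zs" "x \<in> set zs"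
  obtains i where "1 \<le> i" "i \<le> length zs" "place zs f J x = f i"
proof -
  from assms(2) obtain k where "k < length zs" "x = zs ! k" by (auto simp: in_set_conv_nth)
  then show ?thesis using that[of "Suc k"] place_nth[OF assms(1)] by auto
qed

lemma sorted_wrt_place:
  assumes "distinct zs" "strict_mono f"
  shows "sorted_wrt (\<lambda>x y. place zs f J x < place zs f J y) zs"
  unfolding sorted_wrt_iff_nth_less
  using assms by (auto simp: place_nth strict_mono_less)

text \<open>
  All fired vertices lie left of the queue, and the queue spans less than a unit. Hence the head
  \<open>w\<close> overlaps exactly the queued ones among the vertices not yet fired, whereas all later
  vertices are placed beyond the right end of \<open>J w\<close>.
\<close>

definition sa_invariant :: "'a set \<Rightarrow> 'a set set \<Rightarrow> ('a \<Rightarrow> int) \<Rightarrow> 'a sa_state \<Rightarrow> bool" where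
  "sa_invariant V E c S \<longleftrightarrow>
    (let F = sa_fired S; Q = sa_queue S; J = sa_left S in
      F \<union> set Q \<subseteq> V \<and> distinct Q \<and> F \<inter> set Q = {} \<and>
      (\<forall>x\<in>V. sa_conf S x = int (card (neighbors E x)) - c x + int (card (neighbors E x \<inter> F))
        - (if x \<in> F then int (card (neighbors E x)) + 1 else 0)) \<and>
      (\<forall>x\<in>V - F. x \<in> set Q \<longleftrightarrow> c x + 1 \<le> int (card (neighbors E x \<inter> F))) \<and>
      sorted_wrt (\<lambda>x y. J x < J y) Q \<and> (\<forall>x\<in>set Q. \<forall>y\<in>set Q. J y < J x + 1) \<and>
      inj_on J F \<and> (\<forall>x\<in>F. \<forall>y\<in>set Q. J x < J y) \<and>
      sa_orient S = {(u, w). {u, w} \<in> E \<and> u \<in> F \<and> (w \<in> F \<union> set Q \<longrightarrow> J u + 1 < J w)} \<and>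
      (\<forall>x y. {x, y} \<in> E \<longrightarrow>
        ({x, y} \<in> oriented_edges (sa_orient S) \<union> sa_blank S \<longleftrightarrow> x \<in> F \<or> y \<in> F)) \<and>
      (\<forall>x\<in>F \<union> set Q. int (indegree (sa_orient S) x) = c x + 1))"

text \<open>The initially unstable vertices are those with \<open>c x = -1\<close>, matching
  indegree 0. The denominator \<open>k + 1\<close> keeps their left endpoints strictly between 0 and
  1, so the queue spans less than a unit.\<close>

lemma sa_invariant_init:
  assumes G: "simple_graph V E" and c: "\<And>x. x \<in> V \<Longrightarrow> 0 \<le> c x + 1"
    and xs: "distinct xs" "set xs = V"
  shows "sa_invariant V E c (sa_init V E xs c)"
proof -
  define b where "b = (\<lambda>v. cmax V E v - c v)"
  define us where "us = filter (unstable V E b) xs"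
  define f where "f = (\<lambda>i. real i / real (length us + 1))"
  define J where "J = place us f (\<lambda>_. undefined)"
  have init: "sa_init V E xs c =
      \<lparr>sa_conf = b, sa_queue = us, sa_fired = {}, sa_left = J, sa_orient = {}, sa_blank = {}\<rparr>"
    by (simp add: sa_init_def b_def us_def f_def J_def Let_def)
  have b: "b x = int (card (neighbors E x)) - c x" if "x \<in> V" for x
    using that by (simp add: b_def cmax_def cone_degree_eq[OF G])
  have "unstable V E b x \<longleftrightarrow> c x + 1 \<le> 0" if "x \<in> V" for x
    unfolding unstable_def b[OF that] cone_degree_eq[OF G that] using that by auto
  then have us: "distinct us" "set us = {x \<in> V. c x + 1 \<le> 0}"
    using xs by (auto simp: us_def)
  have "strict_mono f" by (intro strict_monoI) (simp add: f_def divide_strict_right_mono)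
  then have "sorted_wrt (\<lambda>x y. J x < J y) us"
    unfolding J_def by (intro sorted_wrt_place us)
  moreover have J: "0 < J x \<and> J x < 1" if x: "x \<in> set us" for x
  proof -
    obtain i where "1 \<le> i" "i \<le> length us" "J x = f i"
      unfolding J_def using place_in[OF us(1) x] by metis
    then show ?thesis by (simp add: f_def)
  qed
  have "J y < J x + 1" if "x \<in> set us" "y \<in> set us" for x y
    using J[OF that(1)] J[OF that(2)] by linarith
  ultimately show ?thesis
    using us b c unfolding init sa_invariant_def
    by (fastforce simp: oriented_edges_def indegree_def)
qed

text \<open>Newly unstable vertices are placed after the right end of \<open>J w\<close>, but early
  enough to overlap everything left in the queue. The last two conclusions provide the termination
  measure.\<close>

lemma sa_invariant_step:
  assumes G: "simple_graph V E" and xs: "distinct xs" "set xs = V"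
    and inv: "sa_invariant V E c S" and ne: "sa_queue S \<noteq> []"
  shows "sa_invariant V E c (sa_step V E xs S)"
    and "sa_fired (sa_step V E xs S) = insert (hd (sa_queue S)) (sa_fired S)"
    and "hd (sa_queue S) \<in> V - sa_fired S"
proof -
  note fin_nb = finite_neighbors[OF G]
  define w where "w = hd (sa_queue S)"
  define rest where "rest = tl (sa_queue S)"
  define F where "F = sa_fired S"
  define J where "J = sa_left S"
  define D where "D = sa_orient S"
  define b where "b = sa_conf S"
  have Q: "sa_queue S = w # rest" using ne by (simp add: w_def rest_def)
  note I = inv[unfolded sa_invariant_def Let_def Q, folded F_def J_def D_def b_def]
  have sub: "F \<subseteq> V" "w \<in> V" "set rest \<subseteq> V" and dist: "w \<notin> set rest" "distinct rest"
    and disj: "w \<notin> F" "F \<inter> set rest = {}" using I by auto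
  have conf: "b x = int (card (neighbors E x)) - c x + int (card (neighbors E x \<inter> F))
        - (if x \<in> F then int (card (neighbors E x)) + 1 else 0)" if "x \<in> V" for x
    using I that by blast
  have queued: "x \<in> set (w # rest) \<longleftrightarrow> c x + 1 \<le> int (card (neighbors E x \<inter> F))"
    if "x \<in> V" "x \<notin> F" for x using I that by blast
  have sorted: "sorted_wrt (\<lambda>x y. J x < J y) rest" "\<And>x. x \<in> set rest \<Longrightarrow> J w < J x"
    using I by auto
  have span: "J y < J x + 1" if "x \<in> set (w # rest)" "y \<in> set (w # rest)" for x y
    using I that by blast
  have inj: "inj_on J F" and left: "\<And>x y. x \<in> F \<Longrightarrow> y \<in> set (w # rest) \<Longrightarrow> J x < J y"
    using I by blast+
  have D: "D = {(u, x). {u, x} \<in> E \<and> u \<in> F \<and> (x \<in> F \<union> set (w # rest) \<longrightarrow> J u + 1 < J x)}"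
    using I by blast
  have decided: "{x, y} \<in> oriented_edges D \<union> sa_blank S \<longleftrightarrow> x \<in> F \<or> y \<in> F" if "{x, y} \<in> E" for x y
    using I that by blast
  have indeg: "int (indegree D x) = c x + 1" if "x \<in> F \<union> set (w # rest)" for x
    using I that by blast
  define F' where "F' = insert w F"
  define b' where "b' = fire_vertex V E w b"
  define e where "e = (case rest of [] \<Rightarrow> 1 | w' # _ \<Rightarrow> J w' - J w)"
  define zs where "zs = filter (\<lambda>z. z \<notin> F' \<and> \<not> unstable V E b z \<and> unstable V E b' z) xs"
  define und where
    "und = {x. {w, x} \<in> E \<and> {w, x} \<notin> oriented_edges D \<and> {w, x} \<notin> sa_blank S}"
  define f where "f = (\<lambda>i. J w + 1 + real i * e / real (length zs + 1))"
  define J' where "J' = place zs f J"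
  define D' where "D' = D \<union> {(w, x) |x. x \<in> und \<and> \<not> unstable V E b x}"
  define B' where "B' = sa_blank S \<union> {{w, x} |x. x \<in> und \<and> unstable V E b x}"
  have step: "sa_step V E xs S = \<lparr>sa_conf = b', sa_queue = rest @ zs, sa_fired = F',
      sa_left = J', sa_orient = D', sa_blank = B'\<rparr>"
    unfolding sa_step_def Let_def F'_def b'_def zs_def J'_def D'_def B'_def f_def e_def und_def
      J_def D_def b_def F_def w_def rest_def by (rule refl)
  have wN: "w \<notin> neighbors E w" by (rule not_neighbor_self[OF G])
  have cardF': "card (neighbors E x \<inter> F') =
      card (neighbors E x \<inter> F) + (if w \<in> neighbors E x then 1 else 0)" for x
    using fin_nb[of x] disj(1) by (simp add: F'_def)
  have conf': "b' x = int (card (neighbors E x)) - c x + int (card (neighbors E x \<inter> F'))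
        - (if x \<in> F' then int (card (neighbors E x)) + 1 else 0)" if "x \<in> V" for x
    using conf[OF that] cone_degree_eq[OF G sub(2)] wN disj(1) neighbors_sym[of w E x] cardF'[of x]
    by (auto simp: b'_def fire_vertex_def F'_def neighbors_def)
  \<comment> \<open>This identifies the test that decides between blank and oriented edges with
    membership in the queue.\<close>
  have unst: "unstable V E b x \<longleftrightarrow> x \<in> set (w # rest)" if "x \<in> V" "x \<notin> F" for x
    unfolding queued[OF that] unstable_def conf[OF that(1)] cone_degree_eq[OF G that(1)]
    using that by auto
  have unst': "unstable V E b' x \<longleftrightarrow> c x + 1 \<le> int (card (neighbors E x \<inter> F'))"
    if "x \<in> V" "x \<notin> F'" for x
    unfolding unstable_def conf'[OF that(1)] cone_degree_eq[OF G that(1)] using that by auto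
  have setz: "set zs = {z \<in> V. z \<notin> F' \<and> z \<notin> set (w # rest) \<and>
      c z + 1 \<le> int (card (neighbors E z \<inter> F'))}"
    using unst unst' by (auto simp: zs_def xs F'_def)
  have distz: "distinct zs" using xs(1) by (simp add: zs_def)
  have fresh: "z \<notin> F'" "z \<notin> set rest" "z \<in> V" if "z \<in> set zs" for z
    using that setz by auto
  \<comment> \<open>One firing adds at most one fired neighbor, so the threshold
    \<open>c z + 1\<close> is first reached with equality.\<close>
  have exact: "int (card (neighbors E z \<inter> F')) = c z + 1" if "z \<in> set zs" for z
  proof -
    have "\<not> c z + 1 \<le> int (card (neighbors E z \<inter> F))"
      using that setz queued[of z] by (auto simp: F'_def)
    moreover have "c z + 1 \<le> int (card (neighbors E z \<inter> F'))" using that setz by simp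
    ultimately show ?thesis using cardF'[of z] by (simp split: if_splits)
  qed
  have queued': "x \<in> set (rest @ zs) \<longleftrightarrow> c x + 1 \<le> int (card (neighbors E x \<inter> F'))"
    if x: "x \<in> V" "x \<notin> F'" for x
  proof (cases "x \<in> set (w # rest)")
    case True
    then have "c x + 1 \<le> int (card (neighbors E x \<inter> F))"
      using x queued[of x] by (simp add: F'_def)
    then have "c x + 1 \<le> int (card (neighbors E x \<inter> F'))" using cardF'[of x] by simp
    then show ?thesis using True x(2) by (simp add: F'_def)
  next
    case False
    then show ?thesis using x setz by simp
  qed
  have Jold: "J' x = J x" if "x \<notin> set zs" for x
    unfolding J'_def using that by (rule place_notin)
  have JF: "J' x = J x" if "x \<in> F'" for x using fresh(1) that Jold by blast
  have JR: "J' x = J x" if "x \<in> set rest" for x using fresh(2) that Jold by blast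
  have epos: "0 < e" using sorted(2) by (auto simp: e_def split: list.split)
  \<comment> \<open>The remaining queue starts at least \<open>e\<close> to the right of
    \<open>w\<close>; an interval starting before \<open>J w + 1 + e\<close> therefore still
    overlaps all of it.\<close>
  have ele: "J w + e \<le> J x" if "x \<in> set rest" for x
    using that sorted(1) by (cases rest) (auto simp: e_def)
  have Jz: "J w + 1 < J' z" "J' z < J w + 1 + e" if z: "z \<in> set zs" for z
  proof -
    obtain i where i: "1 \<le> i" "i \<le> length zs" "J' z = f i"
      unfolding J'_def using place_in[OF distz z] by metis
    have "0 < real i * e / real (length zs + 1)" using i epos by simp
    moreover have "real i * e / real (length zs + 1) < e"
      using i epos by (simp add: divide_simps)
    ultimately show "J w + 1 < J' z" "J' z < J w + 1 + e" by (simp_all add: i(3) f_def)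
  qed
  have Jw: "J x \<le> J w" if "x \<in> F'" for x using that left[of x w] by (auto simp: F'_def)
  have rz: "J' x < J' z" if "x \<in> set rest" "z \<in> set zs" for x z
    using span[of w x] Jz(1)[of z] JR[of x] that by auto
  have "strict_mono f"
    using epos by (intro strict_monoI) (simp add: f_def divide_strict_right_mono)
  then have "sorted_wrt (\<lambda>x y. J' x < J' y) zs"
    unfolding J'_def by (intro sorted_wrt_place distz)
  moreover have "sorted_wrt (\<lambda>x y. J' x < J' y) rest"
    using sorted(1) by (rule sorted_wrt_mono_rel[rotated]) (simp add: JR)
  ultimately have sorted': "sorted_wrt (\<lambda>x y. J' x < J' y) (rest @ zs)"
    using rz by (auto simp: sorted_wrt_append)
  have span': "J' y < J' x + 1" if xy: "x \<in> set (rest @ zs)" "y \<in> set (rest @ zs)" for x y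
  proof (cases "x \<in> set rest")
    case True
    then show ?thesis
      using span[of x y] ele[OF True] Jz(2)[of y] JR xy(2) by fastforce
  next
    case False
    then have x: "J w + 1 < J' x" using xy(1) Jz(1) by auto
    show ?thesis
    proof (cases "y \<in> set rest")
      case True
      then show ?thesis using x span[of w y] JR by fastforce
    next
      case False
      then have y: "J' y < J w + 1 + e" using xy(2) Jz(2) by auto
      \<comment> \<open>Two new left endpoints differ by less than \<open>e\<close>, which is 1 by
        default or else a gap inside the queue.\<close>
      have "e \<le> 1"
      proof (cases rest)
        case (Cons r rs)
        then show ?thesis using span[of w r] by (simp add: e_def)
      qed (simp add: e_def)
      then show ?thesis using x y by linarith
    qed
  qed
  have inj': "inj_on J' F'"
  proof -
    have "inj_on J F'"
      unfolding F'_def using inj left[of _ w] by (fastforce intro: inj_on_insert[THEN iffD2])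
    then show ?thesis using JF by (simp cong: inj_on_cong)
  qed
  have left': "J' x < J' y" if "x \<in> F'" "y \<in> set (rest @ zs)" for x y
  proof (cases "y \<in> set rest")
    case True
    then show ?thesis using Jw[OF that(1)] sorted(2)[OF True] JF[OF that(1)] JR[OF True] by simp
  next
    case False
    then show ?thesis using Jw[OF that(1)] Jz(1)[of y] JF[OF that(1)] that(2) by auto
  qed
  \<comment> \<open>All edges with a fired endpoint are already decided, so the undecided edges at
    \<open>w\<close> lead to the unfired neighbors.\<close>
  have und: "und = {x. {w, x} \<in> E \<and> x \<notin> F}"
    using decided[of w] disj(1) by (auto simp: und_def)
  have inV: "x \<in> V" if "{w, x} \<in> E" for x using simple_graph_edge(2)[OF G that] .
  have D'_alt: "D' = D \<union> {(w, x) |x. {w, x} \<in> E \<and> x \<notin> F \<union> set (w # rest)}"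
    using unst inV by (auto simp: D'_def und)
  \<comment> \<open>The premise on \<open>x\<close> is there because vertices neither fired nor
    queued have no interval yet; arcs to them are recorded before they are placed.\<close>
  have D': "D' = {(u, x). {u, x} \<in> E \<and> u \<in> F' \<and> (x \<in> F' \<union> set (rest @ zs) \<longrightarrow> J' u + 1 < J' x)}"
  proof -
    have "(u, x) \<in> D' \<longleftrightarrow> u \<in> F' \<and> (x \<in> F' \<union> set (rest @ zs) \<longrightarrow> J' u + 1 < J' x)"
      if e: "{u, x} \<in> E" for u x
    proof (cases "x \<in> F \<union> set (w # rest)")
      case True
      then have x: "J' x = J x" "x \<in> F' \<union> set (rest @ zs)" using JF JR by (auto simp: F'_def)
      \<comment> \<open>A fired \<open>x\<close> starts to the left of \<open>w\<close> and a queued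
        one less than a unit after it, so \<open>w\<close> sends no arc to \<open>x\<close>.\<close>
      have "J x < J w + 1" using True left[of x w] span[of w x] by fastforce
      then have "u \<in> F \<and> J u + 1 < J x \<longleftrightarrow> u \<in> F' \<and> J' u + 1 < J x"
        using JF[of u] by (auto simp: F'_def)
      moreover have "(u, x) \<in> D' \<longleftrightarrow> (u, x) \<in> D" using True unfolding D'_alt by blast
      moreover have "(u, x) \<in> D \<longleftrightarrow> u \<in> F \<and> J u + 1 < J x" using True e unfolding D by blast
      ultimately show ?thesis using x by simp
    next
      case False
      \<comment> \<open>Here \<open>x\<close> can only be newly placed, and then it lies beyond the
        right end of \<open>J w\<close>, hence of every fired interval.\<close>
      have "J' u + 1 < J' x" if "u \<in> F'" "x \<in> F' \<union> set (rest @ zs)"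
        using that False Jw[OF that(1)] Jz(1)[of x] JF[OF that(1)] by (auto simp: F'_def)
      moreover have "(u, x) \<in> D' \<longleftrightarrow> u \<in> F'"
        using False e unfolding D'_alt D F'_def by blast
      ultimately show ?thesis by blast
    qed
    moreover have "{u, x} \<in> E" if "(u, x) \<in> D'" for u x
      using that by (auto simp: D'_alt D)
    ultimately show ?thesis by blast
  qed
  have decided': "{x, y} \<in> oriented_edges D' \<union> B' \<longleftrightarrow> x \<in> F' \<or> y \<in> F'" if e: "{x, y} \<in> E" for x y
  proof -
    have "oriented_edges D' \<union> B' = oriented_edges D \<union> sa_blank S \<union> {{w, z} |z. z \<in> und}"
      by (auto simp: D'_def B'_def oriented_edges_def)
    moreover have "{x, y} \<in> {{w, z} |z. z \<in> und} \<longleftrightarrow> x = w \<and> y \<notin> F \<or> y = w \<and> x \<notin> F"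
      using e by (auto simp: und doubleton_eq_iff insert_commute)
    ultimately show ?thesis using decided[OF e] by (auto simp: F'_def)
  qed
  have indeg': "int (indegree D' x) = c x + 1" if "x \<in> F' \<union> set (rest @ zs)" for x
  proof (cases "x \<in> set zs")
    case True
    \<comment> \<open>All fired neighbors are therefore tails of arcs into \<open>x\<close>, and
      their number is known exactly.\<close>
    have "J' u + 1 < J' x" if "u \<in> F'" for u
      using Jw[OF that] Jz(1)[OF True] JF[OF that] by simp
    then have "{u. (u, x) \<in> D'} = neighbors E x \<inter> F'"
      unfolding D' by (auto simp: neighbors_def insert_commute)
    then show ?thesis using exact[OF True] by (simp add: indegree_def)
  next
    case False
    then have x: "x \<in> F \<union> set (w # rest)" using that by (auto simp: F'_def)
    \<comment> \<open>New arcs end outside the fired and queued vertices, so an indegree stays fixed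
      once its vertex is queued.\<close>
    then have "{u. (u, x) \<in> D'} = {u. (u, x) \<in> D}" by (auto simp: D'_alt)
    then show ?thesis using indeg[OF x] by (simp add: indegree_def)
  qed
  have base: "F' \<union> set (rest @ zs) \<subseteq> V" "distinct (rest @ zs)" "F' \<inter> set (rest @ zs) = {}"
    using sub dist disj distz fresh by (auto simp: F'_def)
  show "sa_invariant V E c (sa_step V E xs S)"
    unfolding sa_invariant_def Let_def step sa_state.simps
    by (intro conjI ballI allI impI; (elim DiffE)?;
        rule base conf' queued' sorted' span' inj' left' D' decided' indeg'; assumption)
  show "sa_fired (sa_step V E xs S) = insert (hd (sa_queue S)) (sa_fired S)"
    unfolding step by (simp add: F'_def F_def w_def)
  show "hd (sa_queue S) \<in> V - sa_fired S"
    using sub(2) disj(1) by (simp add: F_def w_def)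
qed

section \<open>Termination and final state of the algorithm\<close>

lemma sa_run_correct:
  assumes G: "simple_graph V E" and c: "c \<in> quasi_superstables V E"
    and xs: "distinct xs" "set xs = V"
  defines "J \<equiv> sa_left (sa_run V E xs c)" and "R \<equiv> sa_orient (sa_run V E xs c)"
  shows "inj_on J V"
    and "R = {(u, w). {u, w} \<in> E \<and> J u + 1 < J w}"
    and "x \<in> V \<Longrightarrow> int (indegree R x) = c x + 1"
proof -
  let ?T = "sa_run V E xs c"
  have fin: "finite V" using G by (simp add: simple_graph_def)
  have c_ge: "0 \<le> c x + 1" if "x \<in> V" for x
    using c that by (simp add: quasi_superstables_iff[OF G])
  have stable: "\<exists>x\<in>X. c x + 1 \<le> int (card (neighbors E x - X))" if "X \<noteq> {}" "X \<subseteq> V" for X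
    using c that by (simp add: quasi_superstables_iff[OF G])
  have "sa_invariant V E c ?T \<and> sa_queue ?T = []"
    unfolding sa_run_def
  proof (rule while_rule[where P = "sa_invariant V E c"
        and r = "measure (\<lambda>S. card (V - sa_fired S))"])
    show "sa_invariant V E c (sa_init V E xs c)"
      by (rule sa_invariant_init[OF G c_ge xs])
    show "sa_invariant V E c (sa_step V E xs S)"
      if "sa_invariant V E c S" "sa_queue S \<noteq> []" for S
      using sa_invariant_step(1)[OF G xs that] .
    show "(sa_step V E xs S, S) \<in> measure (\<lambda>S. card (V - sa_fired S))"
      if "sa_invariant V E c S" "sa_queue S \<noteq> []" for S
    proof -
      have "V - sa_fired (sa_step V E xs S) \<subset> V - sa_fired S"
        using sa_invariant_step(2,3)[OF G xs that] by auto
      then show ?thesis using fin by (simp add: psubset_card_mono)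
    qed
  qed auto
  then have Q: "sa_queue ?T = []" and inv: "sa_invariant V E c ?T" by auto
  note I = inv[unfolded sa_invariant_def Let_def Q]
  have sub: "sa_fired ?T \<subseteq> V" using I by simp
  have "sa_fired ?T = V"
  proof (rule ccontr)
    assume "sa_fired ?T \<noteq> V"
    then have "V - sa_fired ?T \<noteq> {}" using sub by auto
    then obtain x where x: "x \<in> V - sa_fired ?T"
      "c x + 1 \<le> int (card (neighbors E x - (V - sa_fired ?T)))"
      using stable[OF _ Diff_subset] by metis
    \<comment> \<open>The neighbors outside the unfired set are the fired ones, so \<open>x\<close>
      meets the criterion for being queued although the queue is empty.\<close>
    moreover have "neighbors E x - (V - sa_fired ?T) = neighbors E x \<inter> sa_fired ?T"
      using neighbors_subset[OF G] sub by blast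
    ultimately show False using I by auto
  qed
  \<comment> \<open>With every vertex fired, the premise in the description of the arcs always holds
    and the description becomes the claimed one.\<close>
  note I = I[unfolded this]
  show "inj_on J V" unfolding J_def using I by blast
  show "R = {(u, w). {u, w} \<in> E \<and> J u + 1 < J w}"
    unfolding J_def R_def using I simple_graph_edge[OF G] by auto
  show "int (indegree R x) = c x + 1" if "x \<in> V"
    unfolding R_def using I that by auto
qed

section \<open>Vertex orderings, the identities between the maps, and surjectivity\<close>

lemma vertex_order_enumerates:
  assumes "bij_betw v {0..n} V" "\<sigma> \<in> perms_upto n"
  shows "distinct (vertex_order v n \<sigma>)" "set (vertex_order v n \<sigma>) = V"
proof -
  have "bij_betw \<sigma> {0..n} {0..n}"
    using assms(2) by (simp add: perms_upto_def permutes_imp_bij)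
  then have "bij_betw (\<lambda>i. v (\<sigma> i)) {0..n} V"
    using bij_betw_trans[OF _ assms(1)] by (simp add: comp_def)
  moreover have "set [0..<Suc n] = {0..n}" by auto
  ultimately show "distinct (vertex_order v n \<sigma>)" "set (vertex_order v n \<sigma>) = V"
    unfolding vertex_order_def bij_betw_def
    by (simp_all only: distinct_map set_map distinct_upt simp_thms)
qed

theorem theorem3p9:
  fixes V :: "'a set" and E :: "'a set set" and v :: "nat \<Rightarrow> 'a" and n :: nat
  assumes "simple_graph V E"
    and "graph_connected V E"
    and "bij_betw v {0..n} V"
  shows
    "theta_map V E \<in> semiorders V \<rightarrow> quasi_superstables V E \<and>
     psi_map V \<in> semiorientations V E \<rightarrow> quasi_superstables V E \<and>
     nu_map E \<in> semiorders V \<rightarrow> semiorientations V E \<and>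
     phi_map V E v n \<in> quasi_superstables V E \<times> perms_upto n \<rightarrow> semiorders V \<and>
     eta_map V E v n \<in> quasi_superstables V E \<times> perms_upto n \<rightarrow> semiorientations V E \<and>
     (\<forall>x \<in> quasi_superstables V E \<times> perms_upto n.
        (theta_map V E \<circ> phi_map V E v n) x = fst x) \<and>
     (\<forall>x \<in> quasi_superstables V E \<times> perms_upto n.
        (nu_map E \<circ> phi_map V E v n) x = eta_map V E v n x) \<and>
     (\<forall>x \<in> quasi_superstables V E \<times> perms_upto n.
        (psi_map V \<circ> eta_map V E v n) x = fst x) \<and>
     (\<forall>P \<in> semiorders V. (psi_map V \<circ> nu_map E) P = theta_map V E P) \<and>
     fst ` (quasi_superstables V E \<times> perms_upto n) = quasi_superstables V E \<and>
     theta_map V E ` semiorders V = quasi_superstables V E \<and>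
     nu_map E ` semiorders V = semiorientations V E \<and>
     psi_map V ` semiorientations V E = quasi_superstables V E"
proof -
  note G = assms(1)
  let ?S = "quasi_superstables V E"
  have nu: "nu_map E P \<in> semiorientations V E" if "P \<in> semiorders V" for P
    by (rule nu_map_semiorientation[OF G that])
  have psi_nu: "psi_map V (nu_map E P) = theta_map V E P" for P
    by (rule psi_map_nu_map[OF G])
  have theta: "theta_map V E P \<in> ?S" if "P \<in> semiorders V" for P
    by (rule theta_map_quasi_superstable[OF G that])
  have psi: "psi_map V R \<in> ?S" if "R \<in> semiorientations V E" for R
    using nu_map_surj[OF G that] theta psi_nu by metis
  have alg: "phi_map V E v n (c, \<sigma>) \<in> semiorders V"
      "nu_map E (phi_map V E v n (c, \<sigma>)) = eta_map V E v n (c, \<sigma>)"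
      "psi_map V (eta_map V E v n (c, \<sigma>)) = c"
      "eta_map V E v n (c, \<sigma>) \<in> semiorientations V E"
    if c: "c \<in> ?S" and \<sigma>: "\<sigma> \<in> perms_upto n" for c \<sigma>
  proof -
    note run = sa_run_correct[OF G c vertex_order_enumerates[OF assms(3) \<sigma>]]
    show phi: "phi_map V E v n (c, \<sigma>) \<in> semiorders V"
      using run(1) by (auto simp: semiorders_def phi_map_def Let_def)
    show nu_phi: "nu_map E (phi_map V E v n (c, \<sigma>)) = eta_map V E v n (c, \<sigma>)"
      using run(2) simple_graph_edge[OF G] by (auto simp: nu_map_def phi_map_def eta_map_def Let_def)
    show "eta_map V E v n (c, \<sigma>) \<in> semiorientations V E"
      using nu[OF phi] by (simp only: nu_phi)
    \<comment> \<open>Needed for equality as functions: \<open>psi_map\<close> is 0 outside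
      \<open>V\<close>.\<close>
    have "c x = 0" if "x \<notin> V" for x
      using c that by (simp add: quasi_superstables_def divisors_def)
    then show "psi_map V (eta_map V E v n (c, \<sigma>)) = c"
      using run(3) by (auto simp: psi_map_def eta_map_def)
  qed
  \<comment> \<open>A fixed permutation turns the algorithm into a right inverse:
    \<open>phi_map\<close> and \<open>eta_map\<close> at \<open>(c, id)\<close> give preimages of
    \<open>c\<close> under \<open>theta_map\<close> and \<open>psi_map\<close>.\<close>
  have id: "id \<in> perms_upto n" by (simp add: perms_upto_def permutes_id)
  have "c \<in> theta_map V E ` semiorders V \<and> c \<in> psi_map V ` semiorientations V E" if "c \<in> ?S" for c
    using alg[OF that id] nu psi_nu by (metis image_eqI)
  moreover have "R \<in> nu_map E ` semiorders V" if "R \<in> semiorientations V E" for R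
    using nu_map_surj[OF G that] by blast
  ultimately show ?thesis
    using nu psi theta alg id by (auto simp: psi_nu[symmetric])
qed

end
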